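(* Let $d\ge1$ and let $x_1,\dots,x_d$ be independent exponential random variables with $\mathbb{E}(x_j)=1/\lambda_j$, where $0<\lambda_j<\infty$. Let the value of a set $u\subseteq\{1,\dots,d\}$ be $\operatorname{val}(u)=\mathbb{E}(\max_{j\in u}x_j)$. Then for each $j\in\{1,\dots,d\}$ the Shapley value of $j$ is $$\phi_j=\sum_{r=1}^d\frac{(-1)^{r-1}}{r}\sum_{\substack{w\subseteq\{1,\dots,d\}\\ j\in w,\ |w|=r}}\frac{1}{\sum_{\ell\in w}\lambda_\ell}.$$
   Context: For a value function $\operatorname{val}$ on subsets of $\{1,\dots,d\}$ with $\operatorname{val}(\varnothing)=0$ (always assumed; in particular the maximum over the empty set is taken to be $0$), the Shapley value of $j\in\{1,\dots,d\}$ is $$\phi_j=\frac1d\sum_{u\subseteq\{1,\dots,d\}\setminus\{j\}}\binom{d-1}{|u|}^{-1}\bigl(\operatorname{val}(u\cup\{j\})-\operatorname{val}(u)\bigr),$$ where $|u|$ denotes the cardinality of $u$. *)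

theory Defs
  imports "HOL-Probability.Probability"
begin

definition shapley_value :: "nat \<Rightarrow> (nat set \<Rightarrow> real) \<Rightarrow> nat \<Rightarrow> real" where
  "shapley_value d val j =
     1 / real d *
     (\<Sum>u\<in>Pow ({1..d} - {j}).
        inverse (real ((d - 1) choose card u)) * (val (u \<union> {j}) - val u))"

text \<open>The maximum over the empty set is 0 by convention; \<^const>\<open>Max\<close> is
  unspecified there, so this case is separated.\<close>

definition max_over :: "'i set \<Rightarrow> ('i \<Rightarrow> real) \<Rightarrow> real" where
  "max_over u f = (if u = {} then 0 else Max (f ` u))"

definition expected_max :: "'a measure \<Rightarrow> ('i \<Rightarrow> 'a \<Rightarrow> real) \<Rightarrow> 'i set \<Rightarrow> real" where
  "expected_max M x u = (\<integral>\<omega>. max_over u (\<lambda>i. x i \<omega>) \<partial>M)"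

end

theory Submission
  imports Defs
begin

text \<open>
  Adding \<open>j\<close> to \<open>u\<close> raises the maximum by \<open>max 0 (x\<^sub>j - max\<^sub>u x)\<close>, which inclusion-exclusion
  writes as an alternating sum over \<open>v \<subseteq> u\<close> of the minima of \<open>x\<close> over \<open>v \<union> {j}\<close>. A minimum of
  independent exponentials is exponential and the rates add up, so its expectation is
  \<open>1 / (\<Sum>l\<in>v \<union> {j}. \<lambda>\<^sub>l)\<close>. In the Shapley average each such term receives the total weight
  of all \<open>u \<supseteq> v\<close>, which the hockey-stick identity evaluates to \<open>1 / (card v + 1)\<close>.
\<close>

lemma sum_Pow_insert:
  assumes "finite A" "a \<notin> A"
  shows "sum f (Pow (insert a A)) = sum f (Pow A) + (\<Sum>v\<in>Pow A. f (insert a v))"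
proof -
  have "inj_on (insert a) (Pow A)"
    using assms by (auto simp: inj_on_def)
  moreover have "Pow A \<inter> insert a ` Pow A = {}"
    using assms by auto
  ultimately show ?thesis
    using assms by (simp add: Pow_insert sum.union_disjoint sum.reindex o_def)
qed

text \<open>The bound \<open>c\<close> must be arbitrary: the induction step uses the hypothesis also at \<open>min c (f k)\<close>.\<close>

lemma alternating_sum_Min:
  fixes f :: "'i \<Rightarrow> real"
  assumes "finite u"
  shows "(\<Sum>v\<in>Pow u. (-1) ^ card v * Min (insert c (f ` v))) =
    (if u = {} then c else max 0 (c - Max (f ` u)))"
  using assms
proof (induction u arbitrary: c rule: finite_induct)
  case empty
  then show ?case by simp
next
  case (insert k u)
  have "(\<Sum>v\<in>Pow u. (-1) ^ card (insert k v) * Min (insert c (f ` insert k v))) =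
      - (\<Sum>v\<in>Pow u. (-1) ^ card v * Min (insert (min c (f k)) (f ` v)))"
    unfolding sum_negf [symmetric]
  proof (rule sum.cong [OF refl])
    fix v assume "v \<in> Pow u"
    then have v: "finite v" "k \<notin> v"
      using insert.hyps by (auto intro: finite_subset)
    have "Min (insert c (f ` insert k v)) = Min (insert (min c (f k)) (f ` v))"
      using v by (cases "v = {}") (auto simp: min.assoc)
    then show "(-1) ^ card (insert k v) * Min (insert c (f ` insert k v)) =
        - ((-1) ^ card v * Min (insert (min c (f k)) (f ` v)))"
      using v by simp
  qed
  then show ?case
    using insert.hyps by (auto simp: sum_Pow_insert insert.IH)
qed

text \<open>The bound is taken to be \<open>f j\<close>. For empty \<open>u\<close> the increment is
  \<open>f j\<close> itself, whatever its sign, because the empty maximum is 0; this is the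
  exceptional case of the alternating sum.\<close>

lemma max_over_insert_diff:
  assumes "finite u"
  shows "max_over (insert j u) f - max_over u f =
    (\<Sum>v\<in>Pow u. (-1) ^ card v * Min (f ` insert j v))"
  using alternating_sum_Min [OF assms, of "f j" f] assms
  by (auto simp: max_over_def)

text \<open>Computes the total Shapley weight of the coalitions containing \<open>v\<close>, up to
  the factor \<open>1 / d\<close> with \<open>d = card S + 1\<close>. Grouping by size
  \<open>k\<close> reduces it to the sum of \<open>k choose r\<close> over \<open>k\<close>, divided
  by \<open>n choose r\<close>.\<close>

lemma sum_inverse_binomial_supersets:
  assumes S: "finite S" and v: "v \<subseteq> S"
  shows "(\<Sum>u | v \<subseteq> u \<and> u \<subseteq> S. inverse (real (card S choose card u))) =
    real (card S + 1) / real (card v + 1)"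
proof -
  define n r where "n = card S" and "r = card v"
  have fin: "finite v" and rn: "r \<le> n"
    using S v by (auto simp: n_def r_def card_mono finite_subset)
  \<comment> \<open>For \<open>k < r\<close> the truncated difference \<open>k - r\<close> would
    give the value 1, although no such set exists; hence the restriction on
    \<open>k\<close>.\<close>
  have count: "card {u. v \<subseteq> u \<and> u \<subseteq> S \<and> card u = k} = (n - r) choose (k - r)" if "r \<le> k" for k
  proof -
    have "bij_betw (\<lambda>t. v \<union> t) {t. t \<subseteq> S - v \<and> card t = k - r} {u. v \<subseteq> u \<and> u \<subseteq> S \<and> card u = k}"
    proof (rule bij_betwI [where g = "\<lambda>u. u - v"])
      show "(\<lambda>t. v \<union> t) \<in> {t. t \<subseteq> S - v \<and> card t = k - r} \<rightarrow> {u. v \<subseteq> u \<and> u \<subseteq> S \<and> card u = k}"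
      proof
        fix t assume t: "t \<in> {t. t \<subseteq> S - v \<and> card t = k - r}"
        then have "finite t" "v \<inter> t = {}"
          using S by (auto intro: finite_subset)
        then have "card (v \<union> t) = k"
          using t fin that by (simp add: card_Un_disjoint r_def)
        then show "v \<union> t \<in> {u. v \<subseteq> u \<and> u \<subseteq> S \<and> card u = k}"
          using t v by auto
      qed
      show "(\<lambda>u. u - v) \<in> {u. v \<subseteq> u \<and> u \<subseteq> S \<and> card u = k} \<rightarrow> {t. t \<subseteq> S - v \<and> card t = k - r}"
        using fin by (auto simp: card_Diff_subset r_def)
    qed auto
    then have "card {u. v \<subseteq> u \<and> u \<subseteq> S \<and> card u = k} = card {t. t \<subseteq> S - v \<and> card t = k - r}"
      by (simp add: bij_betw_same_card)
    also have "\<dots> = (n - r) choose (k - r)"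
      using S v fin by (simp add: n_subsets card_Diff_subset n_def r_def)
    finally show ?thesis .
  qed
  have "(\<Sum>u | v \<subseteq> u \<and> u \<subseteq> S. inverse (real (n choose card u))) =
      (\<Sum>k = r..n. \<Sum>u | u \<in> {u. v \<subseteq> u \<and> u \<subseteq> S} \<and> card u = k. inverse (real (n choose card u)))"
  proof (rule sum.group [symmetric])
    show "card ` {u. v \<subseteq> u \<and> u \<subseteq> S} \<subseteq> {r..n}"
      using S card_mono [OF S] card_mono [OF finite_subset [OF _ S], of _ v]
      by (auto simp: n_def r_def)
  qed (use S in auto)
  also have "\<dots> = (\<Sum>k = r..n. real (k choose r) / real (n choose r))"
  proof (rule sum.cong [OF refl])
    fix k assume "k \<in> {r..n}"
    then have k: "r \<le> k" "k \<le> n" by auto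
    have "(\<Sum>u | u \<in> {u. v \<subseteq> u \<and> u \<subseteq> S} \<and> card u = k. inverse (real (n choose card u))) =
        real (card {u. v \<subseteq> u \<and> u \<subseteq> S \<and> card u = k}) / real (n choose k)"
      by (simp add: divide_inverse conj_assoc)
    \<comment> \<open>Both \<open>(n choose k) * (k choose r)\<close> and
      \<open>(n choose r) * ((n - r) choose (k - r))\<close> count nested pairs of subsets of sizes
      \<open>r\<close> and \<open>k\<close>.\<close>
    also have "\<dots> = real (k choose r) / real (n choose r)"
      using arg_cong [OF choose_mult [OF k], of real] k rn
      by (simp add: count field_simps)
    finally show "(\<Sum>u | u \<in> {u. v \<subseteq> u \<and> u \<subseteq> S} \<and> card u = k. inverse (real (n choose card u))) =
        real (k choose r) / real (n choose r)" .
  qed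
  also have "\<dots> = real (\<Sum>k\<le>n. k choose r) / real (n choose r)"
  proof -
    \<comment> \<open>Terms with \<open>k < r\<close> vanish, so the sum may start at 0, as the
      hockey-stick identity requires.\<close>
    have "(\<Sum>k = r..n. k choose r) = (\<Sum>k\<le>n. k choose r)"
      by (rule sum.mono_neutral_left) auto
    then show ?thesis
      by (simp flip: sum_divide_distrib of_nat_sum)
  qed
  also have "\<dots> = real (n + 1) / real (r + 1)"
    \<comment> \<open>The sum is \<open>(n + 1) choose (r + 1)\<close>, and its ratio to
      \<open>n choose r\<close> is the claim; Pascal's rule is disabled to keep this coefficient
      whole.\<close>
    using arg_cong [OF Suc_times_binomial_eq [of n r], of real] rn
    by (simp add: sum_choose_upper field_simps del: binomial_Suc_Suc)
  finally show ?thesis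
    by (simp only: n_def r_def)
qed

text \<open>Purely combinatorial: exchanging the sums over \<open>v \<subseteq> u\<close> leaves
  each \<open>v\<close> with weight \<open>1 / (card v + 1)\<close>. Here \<open>g w\<close> stands
  for the expected minimum over \<open>w\<close>.\<close>

lemma shapley_value_alternating:
  assumes j: "j \<in> {1..d}"
    and val: "\<And>u. u \<subseteq> {1..d} - {j} \<Longrightarrow>
      val (insert j u) - val u = (\<Sum>v\<in>Pow u. (-1) ^ card v * g (insert j v))"
  shows "shapley_value d val j =
    (\<Sum>r = 1..d. (-1) ^ (r - 1) / real r * (\<Sum>w\<in>{w. w \<subseteq> {1..d} \<and> j \<in> w \<and> card w = r}. g w))"
proof -
  define S where "S = {1..d} - {j}"
  have S: "finite S" "j \<notin> S" "insert j S = {1..d}" "card S = d - 1" "d = card S + 1"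
    using j by (auto simp: S_def)
  have "shapley_value d val j =
      1 / real d * (\<Sum>u\<in>Pow S. inverse (real (card S choose card u)) *
        (\<Sum>v\<in>Pow u. (-1) ^ card v * g (insert j v)))"
    unfolding shapley_value_def S_def [symmetric] S(4) [symmetric]
    by (intro arg_cong2 [where f = "(*)"] sum.cong refl) (simp add: val S_def)
  \<comment> \<open>Both indices now range over \<open>Pow S\<close>, tied only by
    \<open>v \<subseteq> u\<close>, so the sums can be swapped.\<close>
  also have "\<dots> = 1 / real d * (\<Sum>u\<in>Pow S. \<Sum>v | v \<in> Pow S \<and> v \<subseteq> u.
      inverse (real (card S choose card u)) * ((-1) ^ card v * g (insert j v)))"
    unfolding sum_distrib_left
    by (intro arg_cong [where f = "sum _"] sum.cong refl) auto
  also have "\<dots> = 1 / real d * (\<Sum>v\<in>Pow S. \<Sum>u | u \<in> Pow S \<and> v \<subseteq> u.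
      inverse (real (card S choose card u)) * ((-1) ^ card v * g (insert j v)))"
    using S(1) by (subst sum.swap_restrict) auto
  also have "\<dots> = 1 / real d * (\<Sum>v\<in>Pow S. real d / real (card v + 1) * ((-1) ^ card v * g (insert j v)))"
  proof -
    have "(\<Sum>u | u \<in> Pow S \<and> v \<subseteq> u. inverse (real (card S choose card u))) = real d / real (card v + 1)"
      if "v \<in> Pow S" for v
      using sum_inverse_binomial_supersets [OF S(1), of v] that S(5)
      by (simp add: conj_commute)
    then show ?thesis
      by (simp flip: sum_distrib_right)
  qed
  also have "\<dots> = (\<Sum>v\<in>Pow S. (-1) ^ card v / real (card v + 1) * g (insert j v))"
    unfolding sum_distrib_left using j by (intro sum.cong refl) simp
  \<comment> \<open>With \<open>w = insert j v\<close> the size grows by one, which turns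
    \<open>card v + 1\<close> into \<open>card w\<close> and the exponent into
    \<open>card w - 1\<close>.\<close>
  also have "\<dots> = (\<Sum>w | w \<subseteq> {1..d} \<and> j \<in> w. (-1) ^ (card w - 1) / real (card w) * g w)"
  proof (rule sum.reindex_bij_witness [where i = "\<lambda>w. w - {j}" and j = "insert j"])
    fix v assume "v \<in> Pow S"
    then have "finite v" "j \<notin> v"
      using S(1,2) by (auto intro: finite_subset)
    then show "(-1) ^ (card (insert j v) - 1) / real (card (insert j v)) * g (insert j v) =
        (-1) ^ card v / real (card v + 1) * g (insert j v)"
      by simp
  qed (use S(1-3) in auto)
  also have "\<dots> = (\<Sum>r = 1..d. \<Sum>w | w \<in> {w. w \<subseteq> {1..d} \<and> j \<in> w} \<and> card w = r.
      (-1) ^ (card w - 1) / real (card w) * g w)"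
  proof (rule sum.group [symmetric])
    show "card ` {w. w \<subseteq> {1..d} \<and> j \<in> w} \<subseteq> {1..d}"
    proof safe
      fix w assume w: "w \<subseteq> {1..d}" "j \<in> w"
      then have "finite w" by (auto intro: finite_subset)
      then have "card w \<noteq> 0" using w by auto
      moreover have "card w \<le> d" using card_mono [OF _ w(1)] by simp
      ultimately show "card w \<in> {1..d}" by simp
    qed
  qed auto
  also have "\<dots> = (\<Sum>r = 1..d. (-1) ^ (r - 1) / real r *
      (\<Sum>w\<in>{w. w \<subseteq> {1..d} \<and> j \<in> w \<and> card w = r}. g w))"
    unfolding sum_distrib_left by (intro sum.cong refl) auto
  finally show ?thesis .
qed

text \<open>An exponential density is the Erlang density of index 0, and integrability is the
  existence of its first moment.\<close>

lemma (in prob_space) exponential_distributed_integrable: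
  assumes "0 < l" "distributed M lborel X (exponential_density l)"
  shows "integrable M X"
  using erlang_ith_moment_integrable [OF assms, of 1] by simp

text \<open>The pointwise inclusion-exclusion formula is integrated term by term; independence
  enters through the law of the minima.\<close>

lemma (in prob_space) expected_max_insert_diff_exponential:
  fixes x :: "'i \<Rightarrow> 'a \<Rightarrow> real"
  assumes I: "finite I" "u \<subseteq> I" "j \<in> I"
    and l: "\<And>i. i \<in> I \<Longrightarrow> 0 < l i"
    and D: "\<And>i. i \<in> I \<Longrightarrow> distributed M lborel (x i) (exponential_density (l i))"
    and ind: "indep_vars (\<lambda>_. borel) x I"
  shows "expected_max M x (insert j u) - expected_max M x u =
    (\<Sum>v\<in>Pow u. (-1) ^ card v * (1 / (\<Sum>i\<in>insert j v. l i)))"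
proof -
  have fin: "finite w" if "w \<subseteq> I" for w
    using I(1) that by (rule finite_subset [rotated])
  have int_x: "integrable M (x i)" if "i \<in> I" for i
    using exponential_distributed_integrable [OF l D] that by blast
  have int_max: "integrable M (\<lambda>\<omega>. max_over w (\<lambda>i. x i \<omega>))" if "w \<subseteq> I" for w
  proof (cases "w = {}")
    case False
    then have "integrable M (\<lambda>\<omega>. MAX i\<in>w. x i \<omega>)"
      using that by (intro integrable_MAX fin int_x) auto
    then show ?thesis
      using False by (simp add: max_over_def)
  qed (simp add: max_over_def)
  \<comment> \<open>By independence the tails \<open>exp (- l i * t)\<close> multiply, so the rates
    add. An empty \<open>w\<close> has no minimum and total rate 0.\<close>
  have Min: "distributed M lborel (\<lambda>\<omega>. Min ((\<lambda>i. x i \<omega>) ` w)) (exponential_density (\<Sum>i\<in>w. l i))"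
    and pos: "0 < (\<Sum>i\<in>w. l i)" if w: "w \<subseteq> I" "w \<noteq> {}" for w
  proof -
    show "distributed M lborel (\<lambda>\<omega>. Min ((\<lambda>i. x i \<omega>) ` w)) (exponential_density (\<Sum>i\<in>w. l i))"
      using w by (intro exponential_distributed_Min fin l D indep_vars_subset [OF ind]) auto
    show "0 < (\<Sum>i\<in>w. l i)"
      using w by (intro sum_pos fin l) auto
  qed
  have "expected_max M x (insert j u) - expected_max M x u =
      expectation (\<lambda>\<omega>. max_over (insert j u) (\<lambda>i. x i \<omega>) - max_over u (\<lambda>i. x i \<omega>))"
    unfolding expected_max_def
    using I by (intro Bochner_Integration.integral_diff [symmetric] int_max) auto
  also have "\<dots> = expectation (\<lambda>\<omega>. \<Sum>v\<in>Pow u. (-1) ^ card v * Min ((\<lambda>i. x i \<omega>) ` insert j v))"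
    using max_over_insert_diff [OF fin [OF I(2)]] by simp
  also have "\<dots> = (\<Sum>v\<in>Pow u. expectation (\<lambda>\<omega>. (-1) ^ card v * Min ((\<lambda>i. x i \<omega>) ` insert j v)))"
    using I by (intro Bochner_Integration.integral_sum integrable_mult_right
        exponential_distributed_integrable [OF pos Min]) auto
  also have "\<dots> = (\<Sum>v\<in>Pow u. (-1) ^ card v * (1 / (\<Sum>i\<in>insert j v. l i)))"
  proof (rule sum.cong [OF refl])
    fix v assume "v \<in> Pow u"
    then have "insert j v \<subseteq> I" using I by auto
    then have "expectation (\<lambda>\<omega>. Min ((\<lambda>i. x i \<omega>) ` insert j v)) = 1 / (\<Sum>i\<in>insert j v. l i)"
      by (intro exponential_distributed_expectation pos Min) auto
    then show "expectation (\<lambda>\<omega>. (-1) ^ card v * Min ((\<lambda>i. x i \<omega>) ` insert j v)) =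
        (-1) ^ card v * (1 / (\<Sum>i\<in>insert j v. l i))"
      by (simp del: image_insert)
  qed
  finally show ?thesis .
qed

theorem theorem4:
  fixes M :: "'a measure"
    and d :: nat
    and x :: "nat \<Rightarrow> 'a \<Rightarrow> real"
    and lam :: "nat \<Rightarrow> real"
    and j :: nat
  assumes "prob_space M"
    and "d \<ge> 1"
    and "\<And>i. i \<in> {1..d} \<Longrightarrow> 0 < lam i"
    and "\<And>i. i \<in> {1..d} \<Longrightarrow> distributed M lborel (x i) (exponential_density (lam i))"
    and "prob_space.indep_vars M (\<lambda>_. borel) x {1..d}"
    and "j \<in> {1..d}"
  shows "shapley_value d (expected_max M x) j =
    (\<Sum>r = 1..d. (-1) ^ (r - 1) / real r *
       (\<Sum>w\<in>{w. w \<subseteq> {1..d} \<and> j \<in> w \<and> card w = r}. 1 / (\<Sum>l\<in>w. lam l)))"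
proof -
  interpret prob_space M by fact
  show ?thesis
    \<comment> \<open>Here \<open>g w\<close> is \<open>1 / (\<Sum>l\<in>w. lam l)\<close> and the
      index set \<open>I\<close> is \<open>{1..d}\<close>.\<close>
    using assms by (intro shapley_value_alternating expected_max_insert_diff_exponential) auto
qed

end
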